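(* For every integer $n\ge 0$, $$M(F_{2n+1}(s)) = (2n+1)B_{2n}.$$
   Context: The Fibonacci polynomials $F_n(s)$ are defined by $F_0(s)=0$, $F_1(s)=1$ and $F_n(s)=F_{n-1}(s)+sF_{n-2}(s)$ for $n\ge 2$. The polynomial $F_{2n}(s)$, $n\ge 1$, has degree $n-1$, so the $F_{2n}(s)$, $n\ge1$, form a basis of $\mathbb{C}[s]$; $M$ denotes the linear functional on $\mathbb{C}[s]$ determined by $M(F_2(s))=1$ and $M(F_{2n}(s))=0$ for all $n\ge 2$. The Bernoulli numbers $B_n$ are defined by $B_0=1$ and $B_n=\sum_{k=0}^n\binom{n}{k}B_k$ for $n>1$ (equivalently $\sum_{n\ge 0}B_n\frac{z^n}{n!}=\frac{z}{e^z-1}$). *)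

theory Defs
  imports Complex_Main "HOL-Computational_Algebra.Polynomial"
begin

fun fib_poly :: "nat \<Rightarrow> complex poly" where
  "fib_poly 0 = 0"
| "fib_poly (Suc 0) = 1"
| "fib_poly (Suc (Suc n)) = fib_poly (Suc n) + [:0, 1:] * fib_poly n"

definition is_fib_functional :: "(complex poly \<Rightarrow> complex) \<Rightarrow> bool" where
  "is_fib_functional L \<longleftrightarrow>
     Vector_Spaces.linear smult (*) L \<and>
     L (fib_poly 2) = 1 \<and> (\<forall>n\<ge>2. L (fib_poly (2 * n)) = 0)"

definition fib_functional :: "complex poly \<Rightarrow> complex" where
  "fib_functional = (THE L. is_fib_functional L)"

text \<open>In the recurrence \<open>B n\<close> cancels, so the instance for \<open>n\<close> determines \<open>B (n - 1)\<close>;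
  the instance \<open>n = 1\<close> is excluded and \<open>B 1 = - 1 / 2\<close>.\<close>

definition is_bernoulli :: "(nat \<Rightarrow> real) \<Rightarrow> bool" where
  "is_bernoulli B \<longleftrightarrow>
     B 0 = 1 \<and> (\<forall>n>1. B n = (\<Sum>k=0..n. of_nat (n choose k) * B k))"

definition bernoulli :: "nat \<Rightarrow> real" where
  "bernoulli = (THE B. is_bernoulli B)"


text \<open>Both definite descriptions are well defined.\<close>

lemma coeff_fib_poly_odd_even:
  "(\<forall>k\<ge>n. coeff (fib_poly (2 * n)) k = 0) \<and>
   (\<forall>k>n. coeff (fib_poly (2 * n + 1)) k = 0) \<and>
   coeff (fib_poly (2 * n + 1)) n = 1 \<and>
   coeff (fib_poly (2 * n + 2)) n = of_nat (n + 1)"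
proof (induction n)
  case 0
  show ?case by (simp add: numeral_2_eq_2)
next
  case (Suc n)
  have even: "coeff (fib_poly (2 * Suc n)) k = 0" if "k \<ge> Suc n" for k
    using Suc that by (cases k) (auto simp: coeff_pCons)
  have odd_eq: "fib_poly (2 * Suc n + 1) = fib_poly (2 * Suc n) + [:0, 1:] * fib_poly (2 * n + 1)"
    by simp
  have odd: "coeff (fib_poly (2 * Suc n + 1)) k = 0" if "k > Suc n" for k
    unfolding odd_eq using even[of k] Suc that by (cases k) (auto simp del: fib_poly.simps)
  have top: "coeff (fib_poly (2 * Suc n + 1)) (Suc n) = 1"
    unfolding odd_eq using even[of "Suc n"] Suc by (simp del: fib_poly.simps)
  have next_eq: "fib_poly (2 * Suc n + 2) = fib_poly (2 * Suc n + 1) + [:0, 1:] * fib_poly (2 * n + 2)"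
    by (simp add: numeral_2_eq_2)
  have "coeff (fib_poly (2 * Suc n + 2)) (Suc n) = of_nat (Suc n + 1)"
    unfolding next_eq using top Suc by (simp del: fib_poly.simps)
  with even odd top show ?case by blast
qed

lemma ex1_fib_functional: "\<exists>!L. is_fib_functional L"
proof -
  interpret P: vector_space_pair "smult :: complex \<Rightarrow> _" "(*) :: complex \<Rightarrow> _"
    by unfold_locales (auto simp: algebra_simps smult_add_left smult_add_right)
  define F where "F n = fib_poly (2 * Suc n)" for n
  have F_zero: "coeff (F n) k = 0" if "k > n" for n k
    using coeff_fib_poly_odd_even[of "Suc n"] that unfolding F_def by auto
  have F_top: "coeff (F n) n = of_nat (n + 1)" for n
    using coeff_fib_poly_odd_even[of n] unfolding F_def by (simp del: fib_poly.simps)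
  have F_inj: "inj F"
  proof (rule injI)
    fix m n assume *: "F m = F n"
    have "\<not> m < n" if "F m = F n" for m n
      using F_zero[of m n] F_top[of n] that
      by (metis Suc_eq_plus1 of_nat_eq_0_iff nat.distinct(1))
    from this[of m n] this[of n m] * show "m = n" by force
  qed
  have span_sub: "P.vs1.span (F ` {..<N}) \<subseteq> {p. \<forall>k\<ge>N. coeff p k = 0}" for N
    by (rule P.vs1.span_minimal) (auto simp: P.vs1.subspace_def intro!: F_zero)
  have ind_fin: "P.vs1.independent (F ` {..<N})" for N
  proof (induction N)
    case (Suc N)
    have "F N \<notin> P.vs1.span (F ` {..<N})"
      using span_sub[of N] F_top[of N] by (metis (mono_tags, lifting) Suc_eq_plus1 mem_Collect_eq
          nat.distinct(1) of_nat_eq_0_iff order_refl subsetD)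
    with Suc show ?case by (simp add: lessThan_Suc P.vs1.independent_insertI)
  qed (simp add: P.vs1.independent_empty)
  have ind: "P.vs1.independent (range F)"
    unfolding P.vs1.independent_explicit_finite_subsets
  proof (intro allI impI ballI)
    fix A u v
    assume A: "A \<subseteq> range F" "finite A" and s: "(\<Sum>v\<in>A. smult (u v) v) = 0" and v: "v \<in> A"
    obtain I where I: "finite I" "A = F ` I" using A by (meson finite_subset_image)
    then obtain N where "I \<subseteq> {..<N}" using finite_nat_iff_bounded by auto
    with I have "A \<subseteq> F ` {..<N}" by auto
    with ind_fin[of N] A s v show "u v = 0"
      unfolding P.vs1.independent_explicit_finite_subsets by blast
  qed
  have span_aux: "p \<in> P.vs1.span (range F)" if "\<forall>k\<ge>N. coeff p k = 0" for p N
    using that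
  proof (induction N arbitrary: p)
    case 0
    then have "p = 0" by (simp add: poly_eq_iff)
    then show ?case by (simp add: P.vs1.span_zero)
  next
    case (Suc N)
    define q where "q = smult (coeff p N / of_nat (N + 1)) (F N)"
    have "coeff (p - q) k = 0" if "k \<ge> N" for k
    proof (cases "k = N")
      case True
      have "(of_nat (N + 1) :: complex) \<noteq> 0" by (simp only: of_nat_eq_0_iff)
      with True show ?thesis unfolding q_def by (simp only: coeff_diff coeff_smult F_top) simp
    next
      case False
      with that Suc.prems F_zero[of N k] show ?thesis by (simp add: q_def)
    qed
    then have "p - q \<in> P.vs1.span (range F)" using Suc.IH by blast
    moreover have "q \<in> P.vs1.span (range F)"
      unfolding q_def by (intro P.vs1.span_scale P.vs1.span_base) simp
    ultimately have "(p - q) + q \<in> P.vs1.span (range F)" by (rule P.vs1.span_add)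
    then show ?case by simp
  qed
  have span: "p \<in> P.vs1.span (range F)" for p
    by (rule span_aux[of "Suc (degree p)"]) (auto intro: coeff_eq_0)
  have is_iff: "is_fib_functional L \<longleftrightarrow>
      Vector_Spaces.linear smult (*) L \<and> (\<forall>n. L (F n) = (if n = 0 then 1 else 0))" for L
  proof -
    have "(\<forall>n\<ge>2. L (fib_poly (2 * n)) = 0) \<longleftrightarrow> (\<forall>n>0. L (F n) = 0)"
    proof (intro iffI allI impI)
      fix n :: nat assume "\<forall>n\<ge>2. L (fib_poly (2 * n)) = 0" "n > 0"
      then show "L (F n) = 0" unfolding F_def by (simp del: fib_poly.simps mult_Suc_right)
    next
      fix n :: nat assume *: "\<forall>n>0. L (F n) = 0" "n \<ge> 2"
      from spec[OF *(1), of "n - 1"] *(2) show "L (fib_poly (2 * n)) = 0"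
        unfolding F_def by (simp del: fib_poly.simps mult_Suc_right)
    qed
    moreover have "F 0 = fib_poly 2" by (simp add: F_def numeral_2_eq_2)
    ultimately show ?thesis unfolding is_fib_functional_def by (metis not_gr_zero)
  qed
  show ?thesis
  proof (rule ex_ex1I)
    define g where "g p = (if p = F 0 then 1 else 0 :: complex)" for p
    have "is_fib_functional (P.construct (range F) g)"
      unfolding is_iff using P.linear_construct[OF ind] P.construct_basis[OF ind] F_inj
      by (auto simp: g_def inj_eq)
    show "\<exists>L. is_fib_functional L" by (rule exI) fact
  next
    fix L L' assume "is_fib_functional L" "is_fib_functional L'"
    then have L: "Vector_Spaces.linear smult (*) L" "Vector_Spaces.linear smult (*) L'"
      and eq: "L (F n) = L' (F n)" for n
      unfolding is_iff by simp_all
    show "L = L'"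
    proof
      fix p
      show "L p = L' p"
        by (rule P.linear_eq_on[OF L span[of p]]) (use eq in blast)
    qed
  qed
qed

lemma is_fib_functional_fib_functional: "is_fib_functional fib_functional"
  unfolding fib_functional_def by (rule theI'[OF ex1_fib_functional])

lemma is_bernoulli_iff:
  "is_bernoulli B \<longleftrightarrow>
     (\<forall>n. B n = (if n = 0 then 1 else - (\<Sum>k<n. of_nat (Suc n choose k) * B k) / of_nat (Suc n)))"
proof -
  have alg: "b = S + c * x + b \<longleftrightarrow> x = - S / c" if "c \<noteq> 0" for x S c b :: real
  proof -
    have "b = S + c * x + b \<longleftrightarrow> x * c = - S" by (simp only: mult.commute[of x]) linarith
    also have "\<dots> \<longleftrightarrow> x = - S / c" using that by (rule nonzero_eq_divide_eq[symmetric])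
    finally show ?thesis .
  qed
  have *: "B (Suc n) = (\<Sum>k=0..Suc n. of_nat (Suc n choose k) * B k) \<longleftrightarrow>
      B n = - (\<Sum>k<n. of_nat (Suc n choose k) * B k) / of_nat (Suc n)" for n
  proof -
    have sum_eq: "(\<Sum>k=0..Suc n. of_nat (Suc n choose k) * B k) =
        (\<Sum>k<n. of_nat (Suc n choose k) * B k) + of_nat (Suc n) * B n + B (Suc n)"
      by (simp add: atLeast0AtMost lessThan_Suc_atMost[symmetric] del: binomial_Suc_Suc of_nat_Suc)
    show ?thesis unfolding sum_eq by (rule alg) simp
  qed
  have "(\<forall>n>1. B n = (\<Sum>k=0..n. of_nat (n choose k) * B k)) \<longleftrightarrow>
      (\<forall>n>0. B (Suc n) = (\<Sum>k=0..Suc n. of_nat (Suc n choose k) * B k))"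
    (is "?l \<longleftrightarrow> ?r")
  proof (intro iffI allI impI)
    fix n :: nat assume ?l "n > 0"
    then show "B (Suc n) = (\<Sum>k=0..Suc n. of_nat (Suc n choose k) * B k)"
      by (metis One_nat_def Suc_mono)
  next
    fix n :: nat assume ?r "n > 1"
    then show "B n = (\<Sum>k=0..n. of_nat (n choose k) * B k)"
      by (cases n) (simp_all del: binomial_Suc_Suc of_nat_Suc sum.atLeast0_atMost_Suc)
  qed
  then show ?thesis unfolding is_bernoulli_def * by auto
qed

lemma ex1_bernoulli: "\<exists>!B. is_bernoulli B"
proof (rule ex_ex1I)
  define G :: "(nat \<Rightarrow> real) \<Rightarrow> nat \<Rightarrow> real" where
    "G B n = (if n = 0 then 1 else - (\<Sum>k<n. of_nat (Suc n choose k) * B k) / of_nat (Suc n))" for B n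
  have "adm_wf less_than G"
    unfolding adm_wf_def G_def by (auto intro!: sum.cong)
  then have fix_eq: "wfrec less_than G = G (wfrec less_than G)"
    using wfrec_fixpoint[OF wf_less_than] by blast
  have "is_bernoulli (wfrec less_than G)"
    unfolding is_bernoulli_iff by (rule allI, subst fix_eq, simp only: G_def)
  show "\<exists>B. is_bernoulli B" by (rule exI) fact
next
  fix B B' assume "is_bernoulli B" "is_bernoulli B'"
  note B = this[unfolded is_bernoulli_iff, rule_format]
  show "B = B'"
  proof
    fix n show "B n = B' n"
    proof (induction n rule: less_induct)
      case (less n)
      then have sums: "(\<Sum>k<n. of_nat (Suc n choose k) * B k) = (\<Sum>k<n. of_nat (Suc n choose k) * B' k)"
        by (intro sum.cong refl) (simp only: lessThan_iff)
      show ?case by (simp only: B(1)[of n] B(2)[of n] sums)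
    qed
  qed
qed

lemma is_bernoulli_bernoulli: "is_bernoulli bernoulli"
  unfolding bernoulli_def by (rule theI'[OF ex1_bernoulli])

end

theory Submission
  imports Defs
begin

text \<open>
  Put \<open>s = x (x + 1)\<close>. Then \<open>F\<^sub>n(s)\<close> has the Binet form
  \<open>(1 + 2 x) F\<^sub>n(s) = (1 + x)\<^sup>n - (- x)\<^sup>n\<close>. Let \<open>E\<close> be the umbral functional \<open>x\<^sup>k \<mapsto> B\<^sub>k\<close>; the
  recurrence of the Bernoulli numbers says that \<open>E ((1 + x)\<^sup>k) = E (x\<^sup>k)\<close> for \<open>k \<noteq> 1\<close>. Hence
  \<open>p \<mapsto> E (d/dx ((1 + 2 x) p(x (x + 1)))) / 2\<close> takes the values that define \<open>M\<close> on the
  polynomials \<open>F\<^sub>2\<^sub>n\<close>, so it equals \<open>M\<close>, and on \<open>F\<^sub>2\<^sub>n\<^sub>+\<^sub>1\<close> it gives \<open>(2 n + 1) B\<^sub>2\<^sub>n\<close>.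
\<close>

definition bernoulli_umbra :: "complex poly \<Rightarrow> complex" where
  "bernoulli_umbra p = (\<Sum>k\<le>degree p. coeff p k * of_real (bernoulli k))"

text \<open>The degree can drop in a sum or a scalar multiple; a free upper bound \<open>N\<close>
  lets such polynomials be compared coefficientwise.\<close>

lemma bernoulli_umbra_eq_sum:
  assumes "degree p \<le> N"
  shows "bernoulli_umbra p = (\<Sum>k\<le>N. coeff p k * of_real (bernoulli k))"
  unfolding bernoulli_umbra_def using assms
  by (intro sum.mono_neutral_left) (auto simp: coeff_eq_0)

lemma bernoulli_umbra_add: "bernoulli_umbra (p + q) = bernoulli_umbra p + bernoulli_umbra q"
proof -
  let ?N = "max (degree p) (degree q)"
  have "degree (p + q) \<le> ?N" by (rule degree_add_le_max)
  then show ?thesis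
    by (simp add: bernoulli_umbra_eq_sum[of _ ?N] sum.distrib distrib_right)
qed

lemma bernoulli_umbra_smult: "bernoulli_umbra (smult c p) = c * bernoulli_umbra p"
  by (simp add: bernoulli_umbra_eq_sum[of "smult c p" "degree p"] bernoulli_umbra_def
      degree_smult_le sum_distrib_left mult.assoc)

lemma bernoulli_umbra_monom: "bernoulli_umbra (monom c n) = c * of_real (bernoulli n)"
  by (simp add: bernoulli_umbra_eq_sum[of _ n] degree_monom_le if_distrib if_distribR sum.delta
      cong: if_cong)

lemma bernoulli_umbra_sum: "bernoulli_umbra (\<Sum>i\<in>A. f i) = (\<Sum>i\<in>A. bernoulli_umbra (f i))"
proof (induction A rule: infinite_finite_induct)
  case (insert x A)
  then show ?case by (simp add: bernoulli_umbra_add)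
qed (simp_all add: bernoulli_umbra_def)

text \<open>Binomial expansion yields the right side of the Bernoulli recurrence. At
  \<open>n = 1\<close> the two sides would be 1/2 and -1/2.\<close>

lemma bernoulli_umbra_shift:
  assumes "n \<noteq> 1"
  shows "bernoulli_umbra ([:1, 1:] ^ n) = of_real (bernoulli n)"
proof -
  have "[:1, 1:] ^ n = (monom 1 1 + 1 :: complex poly) ^ n"
    by (simp add: monom_altdef one_pCons)
  also have "\<dots> = (\<Sum>k\<le>n. monom (of_nat (n choose k)) k)"
    by (simp add: binomial_ring monom_power of_nat_poly smult_monom)
  finally have "bernoulli_umbra ([:1, 1:] ^ n) =
      of_real (\<Sum>k\<le>n. of_nat (n choose k) * bernoulli k)"
    by (simp add: bernoulli_umbra_sum bernoulli_umbra_monom)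
  also have "(\<Sum>k\<le>n. of_nat (n choose k) * bernoulli k) = bernoulli n"
  proof (cases "n = 0")
    case False
    with assms show ?thesis
      using is_bernoulli_bernoulli by (simp add: is_bernoulli_def atLeast0AtMost)
  qed simp
  finally show ?thesis .
qed

lemma fib_poly_binet:
  "[:1, 2:] * pcompose (fib_poly n) [:0, 1, 1:] = [:1, 1:] ^ n - [:0, - 1:] ^ n"
proof (induction n rule: fib_poly.induct)
  case (3 n)
  have X: "pcompose [:0, 1:] q = q" for q :: "complex poly"
    by (simp add: pcompose_pCons)
  have "[:1, 2:] * pcompose (fib_poly (Suc (Suc n))) [:0, 1, 1:] =
      [:1, 2:] * pcompose (fib_poly (Suc n)) [:0, 1, 1:] +
      [:0, 1, 1:] * ([:1, 2:] * pcompose (fib_poly n) [:0, 1, 1:])"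
    by (simp only: fib_poly.simps pcompose_add pcompose_mult X distrib_left mult.left_commute)
  also have "\<dots> = ([:1, 1:] + [:0, 1, 1:]) * [:1, 1:] ^ n - ([:0, - 1:] + [:0, 1, 1:]) * [:0, - 1:] ^ n"
    unfolding 3 by (simp only: power_Suc ring_distribs) (simp only: add_diff_eq diff_diff_eq algebra_simps)
  \<comment> \<open>Both 1 + x and -x are roots of t^2 = t + x (x + 1), the characteristic equation
    of the recurrence.\<close>
  also have "[:1, 1:] + [:0, 1, 1:] = [:1, 1:] * ([:1, 1:] :: complex poly)" by simp
  also have "[:0, - 1:] + [:0, 1, 1:] = [:0, - 1:] * ([:0, - 1:] :: complex poly)" by simp
  finally show ?case by (simp only: power_Suc mult.assoc)
qed (simp_all add: one_pCons)

definition umbral_fib_functional :: "complex poly \<Rightarrow> complex" where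
  "umbral_fib_functional p =
     bernoulli_umbra (pderiv ([:1, 2:] * pcompose p [:0, 1, 1:])) / 2"

text \<open>Differentiating the Binet form lowers both exponents to \<open>n\<close> and turns the
  difference into (1 + x)^n + (-x)^n, up to the factor n + 1. For \<open>n \<noteq> 1\<close> the
  two umbral values cancel if \<open>n\<close> is odd and agree if \<open>n\<close> is even.\<close>

lemma umbral_fib_functional_fib_poly:
  "umbral_fib_functional (fib_poly (Suc n)) =
     of_nat (Suc n) * (bernoulli_umbra ([:1, 1:] ^ n) + (- 1) ^ n * of_real (bernoulli n)) / 2"
proof -
  have "[:0, - 1:] ^ n = (monom (- 1) 1 :: complex poly) ^ n"
    by (simp add: monom_altdef)
  then have neg: "[:0, - 1:] ^ n = (monom ((- 1) ^ n) n :: complex poly)"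
    by (simp add: monom_power)
  have "pderiv ([:1, 2:] * pcompose (fib_poly (Suc n)) [:0, 1, 1:]) =
      smult (of_nat (Suc n)) ([:1, 1:] ^ n + monom ((- 1) ^ n) n)"
    unfolding fib_poly_binet pderiv_diff pderiv_power_Suc neg
    by (simp add: pderiv_pCons smult_add_right del: of_nat_Suc)
  then show ?thesis
    unfolding umbral_fib_functional_def
    by (simp only: bernoulli_umbra_smult bernoulli_umbra_add bernoulli_umbra_monom)
qed

lemma is_fib_functional_umbral: "is_fib_functional umbral_fib_functional"
  unfolding is_fib_functional_def
proof (intro conjI allI impI)
  have "vector_space (smult :: complex \<Rightarrow> _)" "vector_space ((*) :: complex \<Rightarrow> _)"
    by unfold_locales (auto simp: algebra_simps smult_add_left smult_add_right)
  then show "Vector_Spaces.linear smult (*) umbral_fib_functional"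
    unfolding Vector_Spaces.linear_iff umbral_fib_functional_def
    by (simp only: pcompose_add pcompose_smult distrib_left mult_smult_right pderiv_add pderiv_smult
        bernoulli_umbra_add bernoulli_umbra_smult add_divide_distrib times_divide_eq_right simp_thms)
next
  have "fib_poly 2 = 1" by (simp add: numeral_2_eq_2)
  then show "umbral_fib_functional (fib_poly 2) = 1"
    using is_bernoulli_bernoulli
    by (simp add: umbral_fib_functional_def bernoulli_umbra_def one_pCons pderiv_pCons is_bernoulli_def)
next
  fix n :: nat assume "n \<ge> 2"
  then obtain m where m: "2 * n = Suc m" "m \<noteq> 1" "odd m"
    using that[of "2 * n - 1"] by simp
  then show "umbral_fib_functional (fib_poly (2 * n)) = 0"
    unfolding m(1) umbral_fib_functional_fib_poly by (simp add: bernoulli_umbra_shift)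
qed

theorem mainTheorem3:
  fixes n :: nat
  shows "fib_functional (fib_poly (2 * n + 1)) = of_nat (2 * n + 1) * of_real (bernoulli (2 * n))"
proof -
  have "fib_functional = umbral_fib_functional"
    using ex1_fib_functional is_fib_functional_fib_functional is_fib_functional_umbral by blast
  \<comment> \<open>The exponent is even, so it is not 1, and the two equal summands absorb the
    division by 2.\<close>
  moreover have "bernoulli_umbra ([:1, 1:] ^ (2 * n)) = of_real (bernoulli (2 * n))"
    by (rule bernoulli_umbra_shift) presburger
  ultimately show ?thesis
    using umbral_fib_functional_fib_poly[of "2 * n"] by (simp del: of_nat_Suc fib_poly.simps)
qed

end
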